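(* Consider the model $Y=X\beta^*+\sigma\xi$ with $\xi_1,\dots,\xi_n$ i.i.d. $N(0,1)$, and integers $s,s_0,m,d$ with $25\le s<m/2$, $s_0<d/2$, $ss_0\ge87$, and $s\le0.061\,s_0^{-1/6}\exp(0.1563\,s_0)$. Assume that the design matrix $X$ satisfies DSRIP$(s,s_0,\delta)$ with arbitrary $\delta\in(0,1)$. If $b>0$ satisfies $$b^2\le\frac{\sigma^2}{10n}\left(\frac{\log(m-s)}{1+\delta}+\frac{s_0}{20}\log(sd-ss_0)\right),$$ then $$\inf_{\hat\eta\in\{0,1\}^{d\times m}}\ \sup_{\beta^*\in\Theta_g(s,s_0,b)}\mathbf E_{Y\sim P_{\beta^*}}\Big\{\sum_{(i,j)\in[d]\times[m]}|\hat\eta_{ij}-\eta^*_{ij}|\Big\}\ge\frac{(ss_0)^{4/5}}{100},$$ or $$\inf_{\hat\eta_G\in\{0,1\}^m}\ \sup_{\beta^*\in\Theta_g(s,s_0,b)}\mathbf E_{Y\sim P_{\beta^*}}\Big\{\sum_{j\in[m]}|(\hat\eta_G)_j-(\eta^*_G)_j|\Big\}\ge\frac{s^{7/10}}{20}.$$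
   Context: **Model.** $n,m,d,s,s_0$ are positive integers, $p=md$, $\sigma>0$. The $p$ coordinates are partitioned into $m$ disjoint groups $G_1,\dots,G_m$ of size $d$; $(i,j)\in[d]\times[m]$ denotes the $i$-th coordinate of group $G_j$ ($[k]=\{1,\dots,k\}$). $X\in\mathbb R^{n\times p}$ is a fixed design whose columns $X_{(ij)}$ satisfy $\|X_{(ij)}\|_2=\sqrt n$. $P_{\beta^*}$ denotes the law $N(X\beta^*,\sigma^2I_n)$ of $Y$. **Parameter spaces.** $\Theta(s,s_0)=\{\beta\in\mathbb R^p:\sum_{j=1}^m\mathbf 1(\beta_{G_j}\ne\mathbf 0_d)\le s,\ \|\beta\|_0\le ss_0\}$ ($\|\beta\|_0$ is the number of nonzero entries), and $\Theta_g(s,s_0,b)=\{\beta\in\Theta(s,s_0):\min_{j\in G^*(\beta)}\|\beta_{G_j}\|_2\ge b\}$, where $G^*(\beta)=\{j\in[m]:\beta_{G_j}\ne\mathbf 0_d\}$. $\mathcal S(s,s_0)=\{\mathrm{supp}(\beta):\beta\in\Theta(s,s_0)\}$ with $\mathrm{supp}(\beta)=\{(i,j):\beta_{ij}\neq0\}$. **DSRIP.** $X$ satisfies DSRIP$(s,s_0,\delta)$ if $n(1-\delta)\|u\|_2^2\le\|X_Su\|_2^2\le n(1+\delta)\|u\|_2^2$ for all $S\in\mathcal S(s,s_0)$ and all nonzero $u\in\mathbb R^{|S|}$, where $X_S$ is the submatrix of columns indexed by $S$. **Selectors.** $\eta^*_{ij}=\mathbf 1(\beta^*_{ij}\ne0)$,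 $(\eta^*_G)_j=\mathbf 1(\beta^*_{G_j}\ne\mathbf 0_d)$. The infima are over all (measurable) selectors $\hat\eta=\hat\eta(Y,X)\in\{0,1\}^{d\times m}$, respectively $\hat\eta_G=\hat\eta_G(Y,X)\in\{0,1\}^m$. *)

theory Defs
  imports "HOL-Probability.Probability"
begin

text \<open>
  The dimensions are carried by finite index types: \<open>n = CARD('n)\<close>, \<open>d = CARD('d)\<close>,
  \<open>m = CARD('m)\<close>.  A coefficient vector has type \<open>real ^ ('d \<times> 'm)\<close>, and \<open>(i, j)\<close> is the
  \<open>i\<close>-th coordinate of the \<open>j\<close>-th group.
\<close>

definition supp :: "real ^ 'k \<Rightarrow> 'k set" where
  "supp \<beta> = {k. \<beta> $ k \<noteq> 0}"

definition group_part :: "real ^ ('d::finite \<times> 'm::finite) \<Rightarrow> 'm \<Rightarrow> real ^ 'd" where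
  "group_part \<beta> j = (\<chi> i. \<beta> $ (i, j))"

definition active_groups :: "real ^ ('d::finite \<times> 'm::finite) \<Rightarrow> 'm set" where
  "active_groups \<beta> = {j. group_part \<beta> j \<noteq> 0}"

definition Theta :: "nat \<Rightarrow> nat \<Rightarrow> (real ^ ('d::finite \<times> 'm::finite)) set" where
  "Theta s s\<^sub>0 = {\<beta>. card (active_groups \<beta>) \<le> s \<and> card (supp \<beta>) \<le> s * s\<^sub>0}"

text \<open>The minimum over an empty set of active groups counts as \<open>\<infinity>\<close>, so \<open>0\<close> is a member.\<close>

definition Theta_g :: "nat \<Rightarrow> nat \<Rightarrow> real \<Rightarrow> (real ^ ('d::finite \<times> 'm::finite)) set" where
  "Theta_g s s\<^sub>0 b = {\<beta> \<in> Theta s s\<^sub>0. \<forall>j\<in>active_groups \<beta>. norm (group_part \<beta> j) \<ge> b}"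

definition supports :: "nat \<Rightarrow> nat \<Rightarrow> ('d::finite \<times> 'm::finite) set set" where
  "supports s s\<^sub>0 = supp ` Theta s s\<^sub>0"

text \<open>
  A vector indexed by \<open>S\<close> is represented by a function of which only the values on \<open>S\<close> matter;
  \<open>(\<Sum>k\<in>S. u k *\<^sub>R column k X)\<close> is the product of the column submatrix of \<open>S\<close> with it.
\<close>

definition DSRIP :: "real ^ ('d::finite \<times> 'm::finite) ^ 'n::finite \<Rightarrow> nat \<Rightarrow> nat \<Rightarrow> real \<Rightarrow> bool" where
  "DSRIP X s s\<^sub>0 \<delta> \<longleftrightarrow>
     (\<forall>S\<in>supports s s\<^sub>0. \<forall>u :: 'd \<times> 'm \<Rightarrow> real. (\<exists>k\<in>S. u k \<noteq> 0) \<longrightarrow>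
        real CARD('n) * (1 - \<delta>) * (\<Sum>k\<in>S. (u k)\<^sup>2) \<le> (norm (\<Sum>k\<in>S. u k *\<^sub>R column k X))\<^sup>2 \<and>
        (norm (\<Sum>k\<in>S. u k *\<^sub>R column k X))\<^sup>2 \<le> real CARD('n) * (1 + \<delta>) * (\<Sum>k\<in>S. (u k)\<^sup>2))"

definition noise :: "('n::finite \<Rightarrow> real) measure" where
  "noise = (\<Pi>\<^sub>M k\<in>UNIV. density lborel (\<lambda>x. ennreal (std_normal_density x)))"

definition observation_law ::
  "real ^ 'k::finite ^ 'n::finite \<Rightarrow> real \<Rightarrow> real ^ 'k \<Rightarrow> (real ^ 'n) measure" where
  "observation_law X \<sigma> \<beta> = distr noise borel (\<lambda>\<xi>. X *v \<beta> + \<sigma> *\<^sub>R (\<chi> k. \<xi> k))"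

lemma observation_map_measurable:
  "(\<lambda>\<xi>. X *v \<beta> + \<sigma> *\<^sub>R (\<chi> k. \<xi> k)) \<in> borel_measurable (noise :: ('n::finite \<Rightarrow> real) measure)"
proof -
  have comp: "(\<lambda>\<xi>::'n \<Rightarrow> real. \<xi> k) \<in> borel_measurable noise" for k
  proof -
    have "(\<lambda>\<xi>::'n \<Rightarrow> real. \<xi> k) \<in> measurable noise
            (density lborel (\<lambda>x. ennreal (std_normal_density x)))"
      unfolding noise_def by (rule measurable_component_singleton) simp
    then show ?thesis by (simp cong: measurable_cong_sets)
  qed
  have "(\<lambda>\<xi>::'n \<Rightarrow> real. \<chi> k. \<xi> k) \<in> borel_measurable noise"
    unfolding borel_measurable_euclidean_space[where f = "\<lambda>\<xi>. \<chi> k. \<xi> k"]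
    using comp by (auto simp: Basis_vec_def inner_axis)
  then show ?thesis by (intro borel_measurable_add borel_measurable_scaleR) auto
qed

lemma prob_space_observation_law:
  fixes X :: "real ^ 'k::finite ^ 'n::finite"
  shows "prob_space (observation_law X \<sigma> \<beta>)"
proof -
  have "prob_space (noise :: ('n \<Rightarrow> real) measure)"
    unfolding noise_def by (intro prob_space_PiM prob_space_normal_density) simp
  then show ?thesis
    unfolding observation_law_def by (rule prob_space.prob_space_distr[OF _ observation_map_measurable])
qed

text \<open>The design is fixed, so a selector is a function of the observation alone.\<close>

definition selectors :: "(real ^ 'n::finite \<Rightarrow> 'k \<Rightarrow> real) set" where
  "selectors = {\<eta>. \<forall>k. (\<forall>y. \<eta> y k \<in> {0, 1}) \<and> (\<lambda>y. \<eta> y k) \<in> borel_measurable borel}"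

definition entry_pattern :: "real ^ ('d::finite \<times> 'm::finite) \<Rightarrow> 'd \<times> 'm \<Rightarrow> real" where
  "entry_pattern \<beta> k = of_bool (\<beta> $ k \<noteq> 0)"

definition group_pattern :: "real ^ ('d::finite \<times> 'm::finite) \<Rightarrow> 'm \<Rightarrow> real" where
  "group_pattern \<beta> j = of_bool (group_part \<beta> j \<noteq> 0)"

text \<open>
  The expected Hamming loss is taken as a nonnegative integral, so that the infimum and supremum
  are those of the complete lattice of extended nonnegative reals.
\<close>

definition minimax_Hamming_risk ::
  "real ^ 'p::finite ^ 'n::finite \<Rightarrow> real \<Rightarrow> (real ^ 'p) set \<Rightarrow> (real ^ 'p \<Rightarrow> 'k::finite \<Rightarrow> real) \<Rightarrow> ennreal"
  where
  "minimax_Hamming_risk X \<sigma> B pattern =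
     (INF \<eta>\<in>selectors. SUP \<beta>\<in>B.
        \<integral>\<^sup>+ y. ennreal (\<Sum>k\<in>UNIV. \<bar>\<eta> y k - pattern \<beta> k\<bar>) \<partial>observation_law X \<sigma> \<beta>)"

end

theory Submission
  imports Defs
begin

text \<open>
  Both bounds come from one randomised construction. The coordinates that may be active are
  arranged in \<open>K\<close> disjoint blocks of \<open>M \<ge> 2\<close> positions, and in each block exactly one position,
  chosen uniformly and independently, carries the value \<open>a\<close>. A selector that errs on a block pays
  at least \<open>1\<close> there, so the minimax Hamming risk is at least \<open>K\<close> times the probability of
  misidentifying the active position of a block when all other blocks are revealed.

  That is a test between \<open>M\<close> Gaussian laws whose means lie within \<open>\<sigma> t\<close> of a common centre, where
  \<open>t\<^sup>2 = n a\<^sup>2 / \<sigma>\<^sup>2\<close> because every column has norm \<open>\<surd>n\<close>. Its average error probability has two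
  lower bounds: \<open>exp (- t\<^sup>2) / 4\<close> by comparing pairs of positions
  (\<open>observation_law_two_point\<close>), and \<open>1 - sqrt (exp (t\<^sup>2) / M)\<close> by a second moment argument over
  all positions (\<open>observation_law_disjoint_sum\<close>). The first is good for \<open>M \<le> sqrt K\<close>, the second for
  larger \<open>M\<close>; if \<open>t\<^sup>2 \<le> \<theta> ln (K M)\<close> with \<open>\<theta> \<le> 1/5\<close>, the risk is at least
  \<open>K powr (1 - 3\<theta>/2) / 4\<close> (\<open>minimax_Hamming_risk_ge_block\<close>).

  The bound on \<open>b\<^sup>2\<close> is a sum of two terms, and the larger one decides which risk is bounded.
  If \<open>ln (m - s) / (1 + \<delta>)\<close> dominates, the blocks are made of groups: \<open>s\<close> blocks of \<open>\<lfloor>m/s\<rfloor>\<close> groups,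
  an active group having a single entry \<open>b\<close>; here \<open>\<theta> = 1/5\<close>. Otherwise \<open>s\<close> fixed groups are active and
  each is split into \<open>s\<^sub>0\<close> blocks of \<open>\<lfloor>d/s\<^sub>0\<rfloor>\<close> coordinates with \<open>a = b / sqrt s\<^sub>0\<close>, so that every active group
  has norm exactly \<open>b\<close>; here \<open>\<theta> = 1/100\<close>. The conditions \<open>s < m/2\<close> and \<open>s\<^sub>0 < d/2\<close> give \<open>M \<ge> 2\<close>, and in
  both cases \<open>K M\<close> exceeds the argument of the logarithm, as \<open>N - k < k \<lfloor>N/k\<rfloor>\<close>.
\<close>

section \<open>Translations of Gaussian noise\<close>

lemma prob_space_noise: "prob_space (noise :: ('n::finite \<Rightarrow> real) measure)"
  unfolding noise_def by (intro prob_space_PiM prob_space_normal_density) simp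

lemma sets_noise: "sets (noise :: ('n::finite \<Rightarrow> real) measure) = sets (\<Pi>\<^sub>M k\<in>UNIV. borel)"
  unfolding noise_def by (intro sets_PiM_cong) auto

lemma space_noise [simp]: "space noise = UNIV"
  unfolding noise_def by (auto simp: space_PiM)

lemma normal_density_tilt:
  "normal_density \<mu> 1 x = std_normal_density x * exp (\<mu> * x - \<mu>\<^sup>2 / 2)"
  unfolding normal_density_def by (simp add: exp_add[symmetric] power2_eq_square field_simps)

lemma emeasure_normal_tilt:
  assumes A: "A \<in> sets borel"
  shows "emeasure (density lborel (\<lambda>x. ennreal (normal_density \<mu> 1 x))) A
    = (\<integral>\<^sup>+ x. ennreal (exp (\<mu> * x - \<mu>\<^sup>2 / 2)) * indicator A x
         \<partial>density lborel (\<lambda>x. ennreal (std_normal_density x)))"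
proof -
  have "ennreal (normal_density \<mu> 1 x) * indicator A x
      = ennreal (std_normal_density x) * (ennreal (exp (\<mu> * x - \<mu>\<^sup>2 / 2)) * indicator A x)" for x
    unfolding normal_density_tilt[of \<mu>] by (simp add: ennreal_mult' mult.assoc)
  then show ?thesis
    using A by (simp add: emeasure_density nn_integral_density)
qed

lemma emeasure_normal_shift:
  assumes A: "A \<in> sets borel"
  shows "emeasure (density lborel (\<lambda>x. ennreal (normal_density \<mu> 1 x))) A
    = emeasure (density lborel (\<lambda>x. ennreal (std_normal_density x))) ((\<lambda>x. x + \<mu>) -` A)"
proof -
  have B: "(\<lambda>x. x + \<mu>) -` A \<in> sets borel"
    using A measurable_sets_borel[of "\<lambda>x. x + \<mu>" borel A] by simp
  have "emeasure (density lborel (\<lambda>x. ennreal (normal_density \<mu> 1 x))) A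
      = (\<integral>\<^sup>+ x. ennreal (normal_density \<mu> 1 x) * indicator A x \<partial>lborel)"
    using A by (simp add: emeasure_density)
  also have "\<dots> = (\<integral>\<^sup>+ x. ennreal (normal_density \<mu> 1 (\<mu> + 1 * x)) * indicator A (\<mu> + 1 * x) \<partial>lborel)"
    using A by (subst nn_integral_real_affine[where c = 1 and t = \<mu>]) auto
  also have "\<dots> = (\<integral>\<^sup>+ x. ennreal (std_normal_density x) * indicator ((\<lambda>x. x + \<mu>) -` A) x \<partial>lborel)"
    by (intro nn_integral_cong) (auto simp: normal_density_def indicator_def add.commute)
  finally show ?thesis using B by (simp add: emeasure_density)
qed

text \<open>The likelihood ratio of \<open>N(h, I)\<close> with respect to \<open>N(0, I)\<close>.\<close>
definition tilt :: "real ^ 'n::finite \<Rightarrow> ('n \<Rightarrow> real) \<Rightarrow> real" where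
  "tilt h \<xi> = exp (h \<bullet> (\<chi> k. \<xi> k) - (norm h)\<^sup>2 / 2)"

lemma shift_measurable:
  fixes h :: "real ^ 'n::finite"
  shows "(\<lambda>\<xi> k. \<xi> k + h $ k) \<in> measurable noise noise"
proof -
  have comp: "(\<lambda>\<xi>. \<xi> k) \<in> borel_measurable (noise :: ('n \<Rightarrow> real) measure)" for k
    using measurable_component_singleton[of k UNIV "\<lambda>k. borel"]
    by (simp cong: measurable_cong_sets add: sets_noise)
  have "(\<lambda>\<xi>. \<lambda>k\<in>UNIV. \<xi> k + h $ k) \<in> measurable noise (\<Pi>\<^sub>M k\<in>UNIV. borel)"
    using comp by (intro measurable_restrict) simp
  then show ?thesis
    by (simp add: restrict_def sets_noise cong: measurable_cong_sets)
qed

text \<open>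
  The finite-dimensional Cameron--Martin formula. Both sides give a box the product of its
  one-dimensional normal probabilities, since the tilt factors over the coordinates, and boxes
  determine a measure on the product.
\<close>
lemma noise_shift:
  fixes h :: "real ^ 'n::finite"
  shows "distr noise noise (\<lambda>\<xi> k. \<xi> k + h $ k)
    = density noise (\<lambda>\<xi>. ennreal (tilt h \<xi>))"
proof -
  define N where "N = (\<lambda>\<mu>. density lborel (\<lambda>x. ennreal (normal_density \<mu> 1 x)))"
  have N0: "density lborel (\<lambda>x. ennreal (std_normal_density x)) = N 0"
    by (simp add: N_def)
  have noise: "(noise :: ('n \<Rightarrow> real) measure) = (\<Pi>\<^sub>M k\<in>UNIV. N 0)"
    by (simp add: noise_def N0)
  have sets_N [simp]: "sets (N \<mu>) = sets borel" for \<mu> by (simp add: N_def)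
  have space_N [simp]: "space (N \<mu>) = UNIV" for \<mu> by (simp add: N_def)
  have pN: "prob_space (N \<mu>)" for \<mu>
    unfolding N_def by (rule prob_space_normal_density) simp
  interpret P0: product_sigma_finite "\<lambda>k::'n. N 0"
    using pN by (intro product_sigma_finite.intro) (simp add: prob_space_imp_sigma_finite)
  interpret Ph: product_sigma_finite "\<lambda>k::'n. N (h $ k)"
    using pN by (intro product_sigma_finite.intro) (simp add: prob_space_imp_sigma_finite)
  have sets_eq: "sets (\<Pi>\<^sub>M k\<in>UNIV. N 0) = sets (\<Pi>\<^sub>M k\<in>UNIV. N (h $ k))"
    by (intro sets_PiM_cong) auto
  have tilt_prod: "tilt h \<xi> = (\<Prod>k\<in>UNIV. exp (h $ k * \<xi> k - (h $ k)\<^sup>2 / 2))"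
    for \<xi> :: "'n \<Rightarrow> real"
  proof -
    have "(norm h)\<^sup>2 = (\<Sum>k\<in>UNIV. (h $ k)\<^sup>2)"
      by (simp only: power2_norm_eq_inner inner_vec_def) (simp add: power2_eq_square)
    then show ?thesis
      by (simp add: tilt_def inner_vec_def sum_subtractf sum_divide_distrib exp_sum[symmetric])
  qed
  have "distr noise noise (\<lambda>\<xi> k. \<xi> k + h $ k) = (\<Pi>\<^sub>M k\<in>UNIV. N (h $ k))"
  proof (rule Ph.PiM_eqI)
    fix A :: "'n \<Rightarrow> real set" assume A: "\<And>k. k \<in> UNIV \<Longrightarrow> A k \<in> sets (N (h $ k))"
    have A': "A k \<in> sets borel" for k using A[of k] by simp
    have B: "(\<lambda>x. x + h $ k) -` A k \<in> sets borel" for k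
      using A' measurable_sets_borel[of "\<lambda>x. x + h $ k" borel "A k"] by simp
    have box: "Pi\<^sub>E UNIV A \<in> sets noise"
      unfolding noise by (rule sets_PiM_I_finite) (use A' in auto)
    have "emeasure (distr noise noise (\<lambda>\<xi> k. \<xi> k + h $ k)) (Pi\<^sub>E UNIV A)
        = emeasure (\<Pi>\<^sub>M k\<in>UNIV. N 0) (Pi\<^sub>E UNIV (\<lambda>k. (\<lambda>x. x + h $ k) -` A k))"
    proof -
      have "(\<lambda>\<xi> k. \<xi> k + h $ k) -` Pi\<^sub>E UNIV A \<inter> space noise
          = Pi\<^sub>E UNIV (\<lambda>k. (\<lambda>x. x + h $ k) -` A k)"
        by (auto simp: PiE_iff)
      then show ?thesis
        unfolding emeasure_distr[OF shift_measurable box] by (simp add: noise)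
    qed
    also have "\<dots> = (\<Prod>k\<in>UNIV. emeasure (N 0) ((\<lambda>x. x + h $ k) -` A k))"
      by (rule P0.emeasure_PiM) (use B in auto)
    also have "\<dots> = (\<Prod>k\<in>UNIV. emeasure (N (h $ k)) (A k))"
      unfolding N_def emeasure_normal_shift[OF A', symmetric] ..
    finally show "emeasure (distr noise noise (\<lambda>\<xi> k. \<xi> k + h $ k)) (Pi\<^sub>E UNIV A)
        = (\<Prod>k\<in>UNIV. emeasure (N (h $ k)) (A k))" .
  qed (simp_all add: noise sets_eq)
  moreover have "density noise (\<lambda>\<xi>. ennreal (tilt h \<xi>))
      = (\<Pi>\<^sub>M k\<in>UNIV. N (h $ k))"
  proof (rule Ph.PiM_eqI)
    fix A :: "'n \<Rightarrow> real set" assume A: "\<And>k. k \<in> UNIV \<Longrightarrow> A k \<in> sets (N (h $ k))"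
    have A': "A k \<in> sets borel" for k using A[of k] by simp
    have box: "Pi\<^sub>E UNIV A \<in> sets noise"
      unfolding noise by (rule sets_PiM_I_finite) (use A' in auto)
    have comp: "(\<lambda>\<xi>. \<xi> k) \<in> borel_measurable (\<Pi>\<^sub>M k\<in>UNIV. N 0)" for k :: 'n
      using measurable_component_singleton[of k UNIV "\<lambda>k. N 0"] by (simp cong: measurable_cong_sets)
    have tm: "(\<lambda>\<xi>. ennreal (tilt h \<xi>)) \<in> borel_measurable noise"
      unfolding tilt_prod noise using comp by simp
    have ind: "indicator (Pi\<^sub>E UNIV A) \<xi> = (\<Prod>k\<in>UNIV. indicator (A k) (\<xi> k) :: ennreal)" for \<xi>
    proof (cases "\<xi> \<in> Pi\<^sub>E UNIV A")
      case False
      then obtain k where "\<xi> k \<notin> A k" by (auto simp: PiE_iff)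
      then have "(\<Prod>k\<in>UNIV. indicator (A k) (\<xi> k) :: ennreal) = 0"
        by (intro prod_zero) (auto intro!: exI[of _ k])
      with False show ?thesis by simp
    qed (simp add: PiE_iff)
    have "emeasure (density noise (\<lambda>\<xi>. ennreal (tilt h \<xi>))) (Pi\<^sub>E UNIV A)
        = (\<integral>\<^sup>+ \<xi>. (\<Prod>k\<in>UNIV. ennreal (exp (h $ k * \<xi> k - (h $ k)\<^sup>2 / 2)) * indicator (A k) (\<xi> k)) \<partial>(\<Pi>\<^sub>M k\<in>UNIV. N 0))"
      unfolding emeasure_density[OF tm box]
      unfolding tilt_prod ind prod.distrib noise by (subst prod_ennreal) auto
    also have "\<dots> = (\<Prod>k\<in>UNIV. \<integral>\<^sup>+ x. ennreal (exp (h $ k * x - (h $ k)\<^sup>2 / 2)) * indicator (A k) x \<partial>N 0)"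
    proof (rule P0.product_nn_integral_prod)
      fix k :: 'n
      have "(\<lambda>x. ennreal (exp (h $ k * x - (h $ k)\<^sup>2 / 2)) * indicator (A k) x) \<in> borel_measurable borel"
        using A'[of k] by measurable
      then show "(\<lambda>x. ennreal (exp (h $ k * x - (h $ k)\<^sup>2 / 2)) * indicator (A k) x) \<in> borel_measurable (N 0)"
        by (simp cong: measurable_cong_sets)
    qed simp
    also have "\<dots> = (\<Prod>k\<in>UNIV. emeasure (N (h $ k)) (A k))"
      unfolding N_def emeasure_normal_tilt[OF A', symmetric] ..
    finally show "emeasure (density noise (\<lambda>\<xi>. ennreal (tilt h \<xi>))) (Pi\<^sub>E UNIV A)
        = (\<Prod>k\<in>UNIV. emeasure (N (h $ k)) (A k))" .
  qed (simp_all add: noise sets_eq)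
  ultimately show ?thesis by simp
qed

lemma tilt_pos: "0 < tilt h \<xi>"
  by (simp add: tilt_def)

lemma affine_map_measurable:
  "(\<lambda>\<xi>. v + \<sigma> *\<^sub>R (\<chi> k. \<xi> k)) \<in> borel_measurable (noise :: ('n::finite \<Rightarrow> real) measure)"
  using borel_measurable_add[OF borel_measurable_const[of v]
      observation_map_measurable[of 0 "0 :: real ^ 'n" \<sigma>]] by simp

lemma tilt_measurable [measurable]: "tilt h \<in> borel_measurable noise"
proof -
  have "(\<lambda>\<xi>. \<chi> k. \<xi> k) \<in> borel_measurable (noise :: ('a \<Rightarrow> real) measure)"
    using affine_map_measurable[of 0 1] by simp
  then show ?thesis unfolding tilt_def by measurable
qed

lemma has_bochner_integral_tilt: "has_bochner_integral noise (tilt h) 1"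
proof (rule has_bochner_integral_nn_integral)
  interpret noise: prob_space "noise :: ('a \<Rightarrow> real) measure" by (rule prob_space_noise)
  interpret shifted: prob_space "density noise (\<lambda>\<xi>. ennreal (tilt h \<xi>))"
    using noise.prob_space_distr[OF shift_measurable[of h]]
    unfolding noise_shift .
  show "(\<integral>\<^sup>+ \<xi>. ennreal (tilt h \<xi>) \<partial>noise) = ennreal 1"
    using shifted.emeasure_space_1 sets.top[of "noise :: ('a \<Rightarrow> real) measure"]
    by (simp add: emeasure_density)
qed (auto simp: tilt_pos less_imp_le)

lemma integrable_tilt: "integrable noise (tilt h)"
  using has_bochner_integral_tilt[of h] by (simp add: has_bochner_integral_iff)

text \<open>
  This and the next identity supply the only moments that are needed: as every tilt integrates to
  \<open>1\<close>, the first gives the second moment \<open>exp ((norm h)\<^sup>2)\<close> of a likelihood ratio.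
\<close>
lemma tilt_power2: "(tilt h \<xi>)\<^sup>2 = exp ((norm h)\<^sup>2) * tilt (2 *\<^sub>R h) \<xi>"
  by (simp add: tilt_def power2_eq_square exp_add[symmetric] exp_diff[symmetric] algebra_simps)

lemma tilt_mult_tilt_uminus: "tilt h \<xi> * tilt (- h) \<xi> = exp (- (norm h)\<^sup>2)"
  by (simp add: tilt_def exp_add[symmetric])

text \<open>
  Every law of the model is rewritten over the same noise space as a tilt around a centre \<open>v\<close> that can
  be chosen freely, so that different parameters can be compared pointwise under one integral.
\<close>
lemma has_bochner_integral_observation_law:
  fixes X :: "real ^ 'p::finite ^ 'n::finite"
  assumes "\<sigma> > 0" and [measurable]: "A \<in> sets borel"
  shows "has_bochner_integral noise
    (\<lambda>\<xi>. indicator A (v + \<sigma> *\<^sub>R (\<chi> k. \<xi> k)) * tilt ((X *v \<beta> - v) /\<^sub>R \<sigma>) \<xi>)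
    (measure (observation_law X \<sigma> \<beta>) A)"
proof -
  define h where "h = (X *v \<beta> - v) /\<^sub>R \<sigma>"
  note [measurable] = affine_map_measurable[of v \<sigma>]
  have comp: "X *v \<beta> + \<sigma> *\<^sub>R (\<chi> k. \<xi> k) = v + \<sigma> *\<^sub>R (\<chi> k. \<xi> k + h $ k)" for \<xi>
    using assms(1) by (simp add: vec_eq_iff h_def field_simps)
  have law: "observation_law X \<sigma> \<beta>
      = distr (density noise (\<lambda>\<xi>. ennreal (tilt h \<xi>))) borel (\<lambda>\<xi>. v + \<sigma> *\<^sub>R (\<chi> k. \<xi> k))"
    unfolding noise_shift[symmetric] observation_law_def comp
    by (subst distr_distr[OF _ shift_measurable]) (simp_all add: comp_def)
  have int: "integrable noise (\<lambda>\<xi>. indicator A (v + \<sigma> *\<^sub>R (\<chi> k. \<xi> k)) * tilt h \<xi>)"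
    by (rule Bochner_Integration.integrable_bound[OF integrable_tilt[of h]])
       (auto simp: indicator_def tilt_pos less_imp_le intro!: AE_I2)
  have "measure (observation_law X \<sigma> \<beta>) A = (\<integral>y. indicator A y \<partial>observation_law X \<sigma> \<beta>)"
    using assms(2) by (simp add: observation_law_def)
  also have "\<dots> = (\<integral>\<xi>. tilt h \<xi> * indicator A (v + \<sigma> *\<^sub>R (\<chi> k. \<xi> k)) \<partial>noise)"
    unfolding law by (subst integral_distr) (auto simp: integral_density tilt_pos less_imp_le)
  finally show ?thesis
    using int by (simp add: has_bochner_integral_iff h_def mult.commute)
qed

section \<open>Errors of Gaussian tests\<close>

lemma has_bochner_integral_mono:
  fixes x y :: real
  assumes "has_bochner_integral M f x" and "has_bochner_integral M g y" and "\<And>z. f z \<le> g z"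
  shows "x \<le> y"
  using assms integral_mono[of M f g] by (auto simp: has_bochner_integral_iff)

text \<open>
  The centre is the midpoint of the two means, so the likelihood ratios are \<open>L = tilt h\<close> and
  \<open>L' = tilt (- h)\<close>, whose product is the constant \<open>q = exp (- (norm h)\<^sup>2)\<close>. The sum of the two
  error probabilities integrates a function that is at least
  \<open>min L L' \<ge> q / (L + L') \<ge> q (1 - (L + L') / 4)\<close>, the last step being the tangent of \<open>1 / W\<close> at the
  mean value \<open>W = 2\<close>. The right-hand side has integral \<open>q / 2\<close>.
\<close>
lemma observation_law_two_point:
  fixes X :: "real ^ 'p::finite ^ 'n::finite"
  assumes "\<sigma> > 0" and A: "A \<in> sets borel"
    and dist: "norm (X *v \<beta> - X *v \<beta>') \<le> 2 * (\<sigma> * t)"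
  shows "exp (- t\<^sup>2) / 2 \<le> measure (observation_law X \<sigma> \<beta>) A + measure (observation_law X \<sigma> \<beta>') (- A)"
proof -
  define v where "v = (X *v \<beta> + X *v \<beta>') /\<^sub>R 2"
  define h where "h = (X *v \<beta> - v) /\<^sub>R \<sigma>"
  define y where "y = (\<lambda>\<xi>. v + \<sigma> *\<^sub>R (\<chi> k. \<xi> k))"
  define q where "q = exp (- (norm h)\<^sup>2)"
  have half: "X *v \<beta> - v = (1 / 2) *\<^sub>R (X *v \<beta> - X *v \<beta>')"
    unfolding v_def by (simp add: vec_eq_iff field_simps)
  have h': "(X *v \<beta>' - v) /\<^sub>R \<sigma> = - h"
    unfolding h_def v_def by (simp add: vec_eq_iff field_simps)
  have "norm h = norm (X *v \<beta> - X *v \<beta>') / (2 * \<sigma>)"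
    unfolding h_def half norm_scaleR using assms(1) by (simp only: abs_of_pos field_simps) simp
  also have "\<dots> \<le> t" using dist assms(1) by (simp add: field_simps)
  finally have "(norm h)\<^sup>2 \<le> t\<^sup>2" by (intro power_mono) auto
  then have q_ge: "exp (- t\<^sup>2) \<le> q" by (simp add: q_def)
  have P: "has_bochner_integral noise (\<lambda>\<xi>. indicator A (y \<xi>) * tilt h \<xi>) (measure (observation_law X \<sigma> \<beta>) A)"
    using has_bochner_integral_observation_law[OF assms(1) A, of v X \<beta>] by (simp add: h_def y_def)
  have P': "has_bochner_integral noise (\<lambda>\<xi>. indicator (- A) (y \<xi>) * tilt (- h) \<xi>)
      (measure (observation_law X \<sigma> \<beta>') (- A))"
    using has_bochner_integral_observation_law[OF assms(1) borel_comp[OF A], of v X \<beta>']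
    by (simp add: h' y_def)
  have below: "has_bochner_integral noise (\<lambda>\<xi>. q * (1 - (tilt h \<xi> + tilt (- h) \<xi>) / 4)) (q * (1 - (1 + 1) / 4))"
  proof -
    interpret noise: prob_space "noise :: ('n \<Rightarrow> real) measure" by (rule prob_space_noise)
    have "has_bochner_integral noise (\<lambda>\<xi>::'n \<Rightarrow> real. 1 :: real) 1"
      using noise.prob_space by (simp add: has_bochner_integral_iff)
    then show ?thesis
      by (intro has_bochner_integral_mult_right has_bochner_integral_diff has_bochner_integral_add
          has_bochner_integral_divide has_bochner_integral_tilt)
  qed
  have pointwise: "a * a' * (1 - (a + a') / 4) \<le> a" if "0 < a" "0 < a'" for a a' :: real
  proof -
    have "0 \<le> (a' - 2)\<^sup>2 + a * a'" using that by (intro add_nonneg_nonneg) auto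
    then have "a' * (1 - (a + a') / 4) \<le> 1"
      by (simp add: power2_eq_square field_simps)
    from mult_left_mono[OF this less_imp_le[OF that(1)]] show ?thesis
      by (simp only: mult.assoc mult_1_right)
  qed
  have "q * (1 - (1 + 1) / 4) \<le> measure (observation_law X \<sigma> \<beta>) A + measure (observation_law X \<sigma> \<beta>') (- A)"
  proof (rule has_bochner_integral_mono[OF below has_bochner_integral_add[OF P P']])
    fix \<xi> :: "'n \<Rightarrow> real"
    have q: "tilt h \<xi> * tilt (- h) \<xi> = q" "tilt (- h) \<xi> * tilt h \<xi> = q"
      unfolding q_def tilt_mult_tilt_uminus[of h \<xi>, symmetric] by (rule refl, rule mult.commute)
    have "q * (1 - (tilt h \<xi> + tilt (- h) \<xi>) / 4) \<le> min (tilt h \<xi>) (tilt (- h) \<xi>)"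
      using pointwise[OF tilt_pos tilt_pos, of h \<xi> "- h" \<xi>]
        pointwise[OF tilt_pos tilt_pos, of "- h" \<xi> h \<xi>]
      unfolding q add.commute[of "tilt (- h) \<xi>"] by (rule min.boundedI)
    then show "q * (1 - (tilt h \<xi> + tilt (- h) \<xi>) / 4)
        \<le> indicator A (y \<xi>) * tilt h \<xi> + indicator (- A) (y \<xi>) * tilt (- h) \<xi>"
      by (cases "y \<xi> \<in> A") simp_all
  qed
  then show ?thesis using q_ge by simp
qed

text \<open>
  For large \<open>card I\<close> no test can succeed, because the success events compete for the same space:
  their indicators add up to at most \<open>1\<close> everywhere, while under the central law each likelihood
  ratio has second moment at most \<open>exp (t\<^sup>2)\<close>. The bound is the Cauchy--Schwarz inequality for the sum of
  the products, obtained here from \<open>z \<le> c/2 + z\<^sup>2/(2c)\<close> with the optimal \<open>c\<close>.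
\<close>
lemma observation_law_disjoint_sum:
  fixes X :: "real ^ 'p::finite ^ 'n::finite"
  assumes "\<sigma> > 0" and "finite I" and "I \<noteq> {}"
    and A: "\<And>i. i \<in> I \<Longrightarrow> A i \<in> sets borel" and disj: "disjoint_family_on A I"
    and near: "\<And>i. i \<in> I \<Longrightarrow> norm (X *v \<beta> i - v) \<le> \<sigma> * t"
  shows "(\<Sum>i\<in>I. measure (observation_law X \<sigma> (\<beta> i)) (A i)) \<le> sqrt (real (card I) * exp (t\<^sup>2))"
proof -
  define h where "h = (\<lambda>i. (X *v \<beta> i - v) /\<^sub>R \<sigma>)"
  define y where "y = (\<lambda>\<xi>. v + \<sigma> *\<^sub>R (\<chi> k. \<xi> k))"
  define c where "c = sqrt (real (card I) * exp (t\<^sup>2))"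
  have "c > 0" using assms(2,3) by (simp add: c_def card_gt_0_iff)
  have h_le: "(norm (h i))\<^sup>2 \<le> t\<^sup>2" if "i \<in> I" for i
  proof -
    have "norm (h i) = norm (X *v \<beta> i - v) / \<sigma>"
      using assms(1) by (simp add: h_def divide_inverse mult.commute)
    also have "\<dots> \<le> t" using near[OF that] assms(1) by (simp add: field_simps)
    finally show ?thesis by (intro power_mono) auto
  qed
  interpret noise: prob_space "noise :: ('n \<Rightarrow> real) measure" by (rule prob_space_noise)
  have one: "has_bochner_integral noise (\<lambda>\<xi>::'n \<Rightarrow> real. 1 :: real) 1"
    using noise.prob_space by (simp add: has_bochner_integral_iff)
  have P: "has_bochner_integral noise (\<lambda>\<xi>. \<Sum>i\<in>I. indicator (A i) (y \<xi>) * tilt (h i) \<xi>)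
      (\<Sum>i\<in>I. measure (observation_law X \<sigma> (\<beta> i)) (A i))"
    unfolding y_def h_def
    by (intro has_bochner_integral_sum has_bochner_integral_observation_law assms(1) A)
  have above: "has_bochner_integral noise
      (\<lambda>\<xi>. c / 2 * 1 + (\<Sum>i\<in>I. exp ((norm (h i))\<^sup>2) * tilt (2 *\<^sub>R h i) \<xi>) / (2 * c))
      (c / 2 * 1 + (\<Sum>i\<in>I. exp ((norm (h i))\<^sup>2) * 1) / (2 * c))"
    by (intro has_bochner_integral_add has_bochner_integral_divide has_bochner_integral_sum
        has_bochner_integral_mult_right has_bochner_integral_tilt one)
  have "(\<Sum>i\<in>I. measure (observation_law X \<sigma> (\<beta> i)) (A i))
      \<le> c / 2 * 1 + (\<Sum>i\<in>I. exp ((norm (h i))\<^sup>2) * 1) / (2 * c)"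
  proof (rule has_bochner_integral_mono[OF P above])
    fix \<xi> :: "'n \<Rightarrow> real"
    have "(\<Sum>i\<in>I. indicator (A i) (y \<xi>)) = (indicator (\<Union>i\<in>I. A i) (y \<xi>) :: real)"
      by (rule indicator_UN_disjoint[OF assms(2) disj, symmetric])
    also have "\<dots> \<le> 1" by (simp add: indicator_def)
    finally have ind: "(\<Sum>i\<in>I. indicator (A i) (y \<xi>)) \<le> (1 :: real)" .
    have am_gm: "z \<le> c / 2 + z\<^sup>2 / (2 * c)" for z :: real
    proof -
      have "0 \<le> (z - c)\<^sup>2" by simp
      then show ?thesis using \<open>c > 0\<close> by (simp add: power2_eq_square field_simps)
    qed
    have "(\<Sum>i\<in>I. indicator (A i) (y \<xi>) * tilt (h i) \<xi>)
        \<le> (\<Sum>i\<in>I. c / 2 * indicator (A i) (y \<xi>) + (tilt (h i) \<xi>)\<^sup>2 / (2 * c))"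
      using am_gm \<open>c > 0\<close> by (intro sum_mono) (simp add: indicator_def)
    also have "\<dots> = c / 2 * (\<Sum>i\<in>I. indicator (A i) (y \<xi>)) + (\<Sum>i\<in>I. (tilt (h i) \<xi>)\<^sup>2) / (2 * c)"
      by (simp add: sum.distrib sum_distrib_left sum_divide_distrib)
    also have "\<dots> \<le> c / 2 * 1 + (\<Sum>i\<in>I. (tilt (h i) \<xi>)\<^sup>2) / (2 * c)"
      using ind \<open>c > 0\<close> by (intro add_right_mono mult_left_mono) auto
    finally show "(\<Sum>i\<in>I. indicator (A i) (y \<xi>) * tilt (h i) \<xi>)
        \<le> c / 2 * 1 + (\<Sum>i\<in>I. exp ((norm (h i))\<^sup>2) * tilt (2 *\<^sub>R h i) \<xi>) / (2 * c)"
      by (simp add: tilt_power2)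
  qed
  also have "\<dots> \<le> c / 2 + (\<Sum>i\<in>I. exp (t\<^sup>2)) / (2 * c)"
    using h_le \<open>c > 0\<close> by (intro add_mono divide_right_mono sum_mono) auto
  also have "(\<Sum>i\<in>I. exp (t\<^sup>2)) = c * c"
    by (simp add: c_def)
  finally show ?thesis using \<open>c > 0\<close> unfolding c_def[symmetric] by simp
qed

text \<open>Sum over all ordered pairs: each \<open>e i\<close> occurs \<open>2 (card I - 1)\<close> times.\<close>
lemma sum_ge_of_pairwise_sum_ge:
  fixes e :: "'i \<Rightarrow> real"
  assumes "finite I" and "2 \<le> card I"
    and pair: "\<And>i i'. i \<in> I \<Longrightarrow> i' \<in> I \<Longrightarrow> i \<noteq> i' \<Longrightarrow> q \<le> e i + e i'"
  shows "real (card I) * q / 2 \<le> sum e I"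
proof -
  define M where "M = real (card I)"
  have "M \<ge> 2" using assms(2) by (simp add: M_def)
  have card': "real (card (I - {i})) = M - 1" if "i \<in> I" for i
    using that assms(1,2) by (simp add: M_def of_nat_diff)
  have "M * ((M - 1) * q) = (\<Sum>i\<in>I. \<Sum>i'\<in>I - {i}. q)"
    using card' by (simp add: M_def)
  also have "\<dots> \<le> (\<Sum>i\<in>I. \<Sum>i'\<in>I - {i}. e i + e i')"
    using pair by (intro sum_mono) auto
  also have "\<dots> = (\<Sum>i\<in>I. (M - 1) * e i + (sum e I - e i))"
    using card' assms(1) by (intro sum.cong) (auto simp: sum.distrib sum_diff1)
  also have "\<dots> = (M - 1) * sum e I + (M * sum e I - sum e I)"
    by (simp add: sum.distrib sum_subtractf sum_distrib_left[symmetric] M_def)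
  also have "\<dots> = (M - 1) * (2 * sum e I)"
    by (simp add: algebra_simps)
  finally have "(M - 1) * (M * q) \<le> (M - 1) * (2 * sum e I)" by (simp add: algebra_simps)
  then show ?thesis using \<open>M \<ge> 2\<close> by (simp add: M_def)
qed

text \<open>
  The pairwise bound uses that the event of deciding for \<open>i'\<close> is part of the error event of \<open>i\<close>; two
  means within \<open>\<sigma> t\<close> of the centre are within \<open>2 \<sigma> t\<close> of each other.
\<close>
lemma identification_error_ge:
  fixes X :: "real ^ 'p::finite ^ 'n::finite"
  assumes "\<sigma> > 0" and "finite I" and "2 \<le> card I"
    and A: "\<And>i. i \<in> I \<Longrightarrow> A i \<in> sets borel" and disj: "disjoint_family_on A I"
    and near: "\<And>i. i \<in> I \<Longrightarrow> norm (X *v \<beta> i - v) \<le> \<sigma> * t"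
  defines "err \<equiv> (\<Sum>i\<in>I. measure (observation_law X \<sigma> (\<beta> i)) (- A i))"
  shows "real (card I) * exp (- t\<^sup>2) / 4 \<le> err"
    and "real (card I) - sqrt (real (card I) * exp (t\<^sup>2)) \<le> err"
proof -
  let ?P = "\<lambda>i. observation_law X \<sigma> (\<beta> i)"
  have compl: "measure (?P i) (- A i) = 1 - measure (?P i) (A i)" if "i \<in> I" for i
  proof -
    interpret prob_space "?P i" by (rule prob_space_observation_law)
    show ?thesis using prob_compl[of "A i"] A[OF that] by (simp add: observation_law_def Compl_eq_Diff_UNIV)
  qed
  have pair: "exp (- t\<^sup>2) / 2 \<le> measure (?P i) (- A i) + measure (?P i') (- A i')"
    if "i \<in> I" "i' \<in> I" "i \<noteq> i'" for i i'
  proof -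
    interpret prob_space "?P i" by (rule prob_space_observation_law)
    have "norm (X *v \<beta> i - X *v \<beta> i') \<le> norm (X *v \<beta> i - v) + norm (X *v \<beta> i' - v)"
      using norm_triangle_ineq4[of "X *v \<beta> i - v" "X *v \<beta> i' - v"] by simp
    also have "\<dots> \<le> 2 * (\<sigma> * t)" using near[OF that(1)] near[OF that(2)] by simp
    finally have "exp (- t\<^sup>2) / 2 \<le> measure (?P i) (A i') + measure (?P i') (- A i')"
      by (intro observation_law_two_point assms(1) A that)
    also have "measure (?P i) (A i') \<le> measure (?P i) (- A i)"
      using that A disj
      by (intro finite_measure_mono) (auto simp: observation_law_def disjoint_family_on_def)
    finally show ?thesis by simp
  qed
  show "real (card I) * exp (- t\<^sup>2) / 4 \<le> err"
    using sum_ge_of_pairwise_sum_ge[OF assms(2,3) pair] unfolding err_def by simp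
  have "I \<noteq> {}" using assms(3) by auto
  from observation_law_disjoint_sum[OF assms(1,2) this A disj near]
  show "real (card I) - sqrt (real (card I) * exp (t\<^sup>2)) \<le> err"
    by (simp add: err_def compl sum_subtractf)
qed

section \<open>Lower bounds from independent blocks\<close>

text \<open>
  Averaging over all choice functions is the same as fixing the choice in every block but \<open>j\<close> and
  averaging over the choice in block \<open>j\<close>; hence a bound for the inner average carries over.
\<close>
lemma sum_PiE_ge:
  fixes F :: "('j \<Rightarrow> 'i) \<Rightarrow> real"
  assumes "finite J" and "finite I" and "j \<in> J"
    and slice: "\<And>g. g \<in> (\<Pi>\<^sub>E _\<in>J - {j}. I) \<Longrightarrow> real (card I) * p \<le> (\<Sum>i\<in>I. F (g(j := i)))"
  shows "real (card (\<Pi>\<^sub>E _\<in>J. I)) * p \<le> (\<Sum>f\<in>(\<Pi>\<^sub>E _\<in>J. I). F f)"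
proof -
  let ?G = "\<Pi>\<^sub>E _\<in>J - {j}. I"
  have J: "insert j (J - {j}) = J" using assms(3) by auto
  have image: "(\<Pi>\<^sub>E _\<in>J. I) = (\<lambda>(i, g). g(j := i)) ` (I \<times> ?G)"
    using PiE_insert_eq[of j "J - {j}" "\<lambda>_. I"] unfolding J by simp
  have inj: "inj_on (\<lambda>(i, g). g(j := i)) (I \<times> ?G)"
    by (rule inj_combinator) simp
  have "real (card (\<Pi>\<^sub>E _\<in>J. I)) * p = (\<Sum>g\<in>?G. real (card I) * p)"
    unfolding image card_image[OF inj] by (simp add: card_cartesian_product)
  also have "\<dots> \<le> (\<Sum>g\<in>?G. \<Sum>i\<in>I. F (g(j := i)))"
    by (intro sum_mono slice)
  also have "\<dots> = (\<Sum>i\<in>I. \<Sum>g\<in>?G. F (g(j := i)))"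
    by (rule sum.swap)
  also have "\<dots> = (\<Sum>(i, g)\<in>I \<times> ?G. F (g(j := i)))"
    by (simp add: sum.cartesian_product)
  also have "\<dots> = (\<Sum>f\<in>(\<Pi>\<^sub>E _\<in>J. I). F f)"
    unfolding image sum.reindex[OF inj] by (simp add: comp_def case_prod_unfold)
  finally show ?thesis .
qed

text \<open>
  The trade-off between the two bounds on the identification error \<open>E\<close>. If \<open>M\<^sup>2 \<le> K\<close>, then
  \<open>ln (K M) \<le> 3/2 ln K\<close> and the pairwise bound has the required order. Otherwise
  \<open>ln (K M) \<le> 3 ln M\<close>, so that \<open>sqrt (M exp (t\<^sup>2)) \<le> M powr (4/5)\<close>, and \<open>M > 5\<close> makes this at most
  \<open>3/4 M\<close>.
\<close>
lemma block_error_arith: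
  fixes K M \<theta> t E :: real
  assumes "25 \<le> K" and "2 \<le> M" and "0 \<le> \<theta>" and "\<theta> \<le> 1 / 5"
    and t: "t\<^sup>2 \<le> \<theta> * ln (K * M)"
    and E1: "M * exp (- t\<^sup>2) / 4 \<le> E" and E2: "M - sqrt (M * exp (t\<^sup>2)) \<le> E"
  shows "M * (K powr (- (3 / 2) * \<theta>) / 4) \<le> E"
proof (cases "M\<^sup>2 \<le> K")
  case True
  have "2 * ln M = ln (M\<^sup>2)" using assms(2) by (simp add: ln_realpow)
  also have "\<dots> \<le> ln K" using True assms(1,2) by simp
  finally have "ln (K * M) \<le> 3 / 2 * ln K"
    using assms(1,2) by (simp add: ln_mult)
  then have "\<theta> * ln (K * M) \<le> \<theta> * (3 / 2 * ln K)"
    using assms(3) by (rule mult_left_mono)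
  then have "K powr (- (3 / 2) * \<theta>) \<le> exp (- t\<^sup>2)"
    using t assms(1) by (simp add: powr_def mult.commute mult.left_commute)
  then have "M * (K powr (- (3 / 2) * \<theta>) / 4) \<le> M * exp (- t\<^sup>2) / 4"
    using assms(2) by simp
  then show ?thesis using E1 by linarith
next
  case False
  have "5\<^sup>2 < M\<^sup>2" using False assms(1) by simp
  then have "5 < M" by (rule power2_less_imp_less) (use assms(2) in simp)
  have "ln K \<le> ln (M\<^sup>2)" using False assms(1,2) by simp
  also have "\<dots> = 2 * ln M" using assms(2) by (simp add: ln_realpow)
  finally have "ln (K * M) \<le> 3 * ln M"
    using assms(1,2) by (simp add: ln_mult)
  moreover have "0 \<le> ln (K * M)" using assms(1,2) by (simp add: ln_mult)
  ultimately have "\<theta> * ln (K * M) \<le> 1 / 5 * (3 * ln M)"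
    using assms(3,4) by (intro mult_mono) auto
  then have "exp (t\<^sup>2) \<le> M powr (3 / 5)"
    using t assms(2) by (simp add: powr_def)
  then have "M * exp (t\<^sup>2) \<le> M powr 1 * M powr (3 / 5)"
    using assms(2) by simp
  also have "\<dots> = (M powr (4 / 5))\<^sup>2"
    unfolding power2_eq_square by (simp only: powr_add[symmetric]) simp
  finally have "sqrt (M * exp (t\<^sup>2)) \<le> M powr (4 / 5)"
    by (simp add: real_le_lsqrt)
  also have "\<dots> = M * M powr (- (1 / 5))"
    using assms(2) powr_add[of M 1 "- (1 / 5)"] by simp
  also have "M powr (- (1 / 5)) \<le> 3 / 4"
  proof -
    \<comment> \<open>\<open>(4/3)\<^sup>5 = 1024/243\<close> lies below \<open>5 < M\<close>; this is where \<open>25 \<le> K\<close> enters.\<close>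
    have "4 / 3 = ((4 / 3) powr 5) powr (1 / 5 :: real)" by (simp only: powr_powr) simp
    also have "(4 / 3 :: real) powr 5 = 1024 / 243" by (simp add: powr_numeral power_divide)
    also have "(1024 / 243) powr (1 / 5 :: real) \<le> M powr (1 / 5)"
      using \<open>5 < M\<close> by (intro powr_mono2) auto
    finally have "inverse (M powr (1 / 5)) \<le> inverse (4 / 3)"
      by (intro le_imp_inverse_le) auto
    then show ?thesis by (simp only: powr_minus) simp
  qed
  finally have "M / 4 \<le> E" using E2 assms(2) by simp
  moreover have "K powr (- (3 / 2) * \<theta>) \<le> K powr 0"
    using assms(1,3) by (intro powr_mono) auto
  then have "M * (K powr (- (3 / 2) * \<theta>) / 4) \<le> M * (1 / 4)"
    using assms(1,2) by (intro mult_left_mono) auto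
  ultimately show ?thesis by simp
qed

text \<open>
  \<open>J\<close> indexes the blocks, \<open>c j i\<close> is the coordinate at position \<open>i\<close> of block \<open>j\<close>, and \<open>f\<close> chooses the
  active position of each block. The sum form makes the image under the design immediate.
\<close>
definition block_signal ::
  "'j set \<Rightarrow> ('j \<Rightarrow> 'i \<Rightarrow> 'p::finite) \<Rightarrow> real \<Rightarrow> ('j \<Rightarrow> 'i) \<Rightarrow> real ^ 'p" where
  "block_signal J c a f = (\<Sum>j\<in>J. a *\<^sub>R axis (c j (f j)) 1)"

lemma block_signal_nth:
  assumes "finite J" and inj: "inj_on (\<lambda>j. c j (f j)) J"
  shows "block_signal J c a f $ k = a * of_bool (k \<in> (\<lambda>j. c j (f j)) ` J)"
proof -
  have "block_signal J c a f $ k = (\<Sum>j\<in>J. (\<lambda>l. if k = l then a else 0) (c j (f j)))"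
    by (simp add: block_signal_def axis_def sum_component if_distrib eq_commute cong: if_cong)
  also have "\<dots> = (\<Sum>l\<in>(\<lambda>j. c j (f j)) ` J. if k = l then a else 0)"
    by (simp add: sum.reindex[OF inj])
  also have "\<dots> = a * of_bool (k \<in> (\<lambda>j. c j (f j)) ` J)"
    using assms(1) by (simp add: sum.delta)
  finally show ?thesis .
qed

lemma matrix_vector_mult_block_signal:
  fixes X :: "real ^ 'p::finite ^ 'n::finite"
  shows "X *v block_signal J c a f = (\<Sum>j\<in>J. a *\<^sub>R column (c j (f j)) X)"
proof -
  have "X *v block_signal J c a f = (\<Sum>j\<in>J. X *v (a *\<^sub>R axis (c j (f j)) 1))"
    unfolding block_signal_def
    by (rule linear_sum[OF matrix_vector_mul_linear])
  then show ?thesis by (simp add: matrix_vector_mult_scaleR matrix_vector_mult_basis)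
qed

text \<open>
  Distinct blocks occupy disjoint parts of the pattern, and a block whose values are not exactly the
  right ones contains at least one wrong binary value, which costs \<open>1\<close>.
\<close>
lemma Hamming_loss_ge_block_errors:
  fixes pos :: "'j \<Rightarrow> 'i \<Rightarrow> 'k::finite" and \<eta> :: "'k \<Rightarrow> real"
  assumes "finite J" and "finite I" and f: "\<And>j. j \<in> J \<Longrightarrow> f j \<in> I"
    and inj: "inj_on (\<lambda>(j, i). pos j i) (J \<times> I)"
    and binary: "\<And>k. \<eta> k \<in> {0, 1}"
    and pat: "\<And>j i. j \<in> J \<Longrightarrow> i \<in> I \<Longrightarrow> pat (pos j i) = of_bool (i = f j)"
  shows "(\<Sum>j\<in>J. of_bool (\<not> (\<forall>i\<in>I. \<eta> (pos j i) = of_bool (i = f j)))) \<le> (\<Sum>k\<in>UNIV. \<bar>\<eta> k - pat k\<bar>)"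
proof -
  have "(\<Sum>j\<in>J. of_bool (\<not> (\<forall>i\<in>I. \<eta> (pos j i) = of_bool (i = f j))))
      \<le> (\<Sum>j\<in>J. \<Sum>i\<in>I. \<bar>\<eta> (pos j i) - pat (pos j i)\<bar>)"
  proof (rule sum_mono)
    fix j assume j: "j \<in> J"
    show "of_bool (\<not> (\<forall>i\<in>I. \<eta> (pos j i) = of_bool (i = f j))) \<le> (\<Sum>i\<in>I. \<bar>\<eta> (pos j i) - pat (pos j i)\<bar>)"
    proof (cases "\<forall>i\<in>I. \<eta> (pos j i) = of_bool (i = f j)")
      case False
      then obtain i where i: "i \<in> I" "\<eta> (pos j i) \<noteq> of_bool (i = f j)" by auto
      then have "1 = \<bar>\<eta> (pos j i) - pat (pos j i)\<bar>"
        using binary[of "pos j i"] pat[OF j i(1)] by (auto simp: of_bool_def split: if_splits)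
      also have "\<dots> \<le> (\<Sum>i\<in>I. \<bar>\<eta> (pos j i) - pat (pos j i)\<bar>)"
        using i(1) assms(2) by (intro member_le_sum) auto
      finally show ?thesis using False by simp
    qed (auto intro: sum_nonneg)
  qed
  also have "\<dots> = (\<Sum>x\<in>J \<times> I. \<bar>\<eta> (case x of (j, i) \<Rightarrow> pos j i) - pat (case x of (j, i) \<Rightarrow> pos j i)\<bar>)"
    by (simp add: sum.cartesian_product case_prod_unfold)
  also have "\<dots> = (\<Sum>k\<in>(\<lambda>(j, i). pos j i) ` (J \<times> I). \<bar>\<eta> k - pat k\<bar>)"
    by (simp add: sum.reindex[OF inj])
  also have "\<dots> \<le> (\<Sum>k\<in>UNIV. \<bar>\<eta> k - pat k\<bar>)"
    by (intro sum_mono2) auto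
  finally show ?thesis .
qed

text \<open>
  The worst case over \<open>B\<close> is at least the average over all choice functions \<open>f\<close>. In that average each
  block contributes its identification error, bounded with the choices in the other blocks held
  fixed, so the blocks need no independence under a single law.
  The maps \<open>c\<close> and \<open>pos\<close> are kept apart because the pattern need not live on the coordinates: for
  group selection, \<open>c j i\<close> is a coordinate and \<open>pos j i\<close> its group.
\<close>
lemma minimax_Hamming_risk_ge_block:
  fixes X :: "real ^ 'p::finite ^ 'n::finite" and c :: "'j \<Rightarrow> 'i \<Rightarrow> 'p"
    and pos :: "'j \<Rightarrow> 'i \<Rightarrow> 'k::finite"
  assumes "\<sigma> > 0" and col: "\<And>k. norm (column k X) = sqrt (real CARD('n))"
    and fin: "finite J" "finite I" and "25 \<le> card J" and "2 \<le> card I"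
    and inj: "inj_on (\<lambda>(j, i). pos j i) (J \<times> I)"
    and mem: "\<And>f. f \<in> (\<Pi>\<^sub>E _\<in>J. I) \<Longrightarrow> block_signal J c a f \<in> B"
    and pat: "\<And>f j i. f \<in> (\<Pi>\<^sub>E _\<in>J. I) \<Longrightarrow> j \<in> J \<Longrightarrow> i \<in> I \<Longrightarrow>
      pattern (block_signal J c a f) (pos j i) = of_bool (i = f j)"
    and "0 \<le> \<theta>" and "\<theta> \<le> 1 / 5"
    and snr: "real CARD('n) * a\<^sup>2 / \<sigma>\<^sup>2 \<le> \<theta> * ln (real (card J) * real (card I))"
  shows "ennreal (real (card J) powr (1 - 3 / 2 * \<theta>) / 4) \<le> minimax_Hamming_risk X \<sigma> B pattern"
  unfolding minimax_Hamming_risk_def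
proof (rule INF_greatest)
  fix \<eta> :: "real ^ 'n \<Rightarrow> 'k \<Rightarrow> real" assume "\<eta> \<in> selectors"
  then have binary: "\<eta> y k \<in> {0, 1}" and [measurable]: "(\<lambda>y. \<eta> y k) \<in> borel_measurable borel" for y k
    by (auto simp: selectors_def)
  define F where "F = (\<Pi>\<^sub>E _\<in>J. I)"
  define P where "P = (\<lambda>f. observation_law X \<sigma> (block_signal J c a f))"
  \<comment> \<open>The event that the selector declares exactly position \<open>i\<close> of block \<open>j\<close> active.\<close>
  define A where "A = (\<lambda>j i. {y. \<forall>i'\<in>I. \<eta> y (pos j i') = of_bool (i' = i)})"
  define t where "t = \<bar>a\<bar> * sqrt (real CARD('n)) / \<sigma>"
  define p where "p = real (card J) powr (- (3 / 2) * \<theta>) / 4"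
  have A_sets: "A j i \<in> sets borel" for j i
  proof -
    have "{y \<in> space borel. \<forall>i'\<in>I. \<eta> y (pos j i') = of_bool (i' = i)} \<in> sets borel"
      using fin(2) by measurable
    then show ?thesis by (simp add: A_def)
  qed
  have t_sq: "t\<^sup>2 \<le> \<theta> * ln (real (card J) * real (card I))"
    using snr by (simp add: t_def power_mult_distrib power_divide mult.commute)
  have slice: "real (card I) * p \<le> (\<Sum>i\<in>I. measure (P (g(j := i))) (- A j i))"
    if j: "j \<in> J" and g: "g \<in> (\<Pi>\<^sub>E _\<in>J - {j}. I)" for j g
  proof -
    \<comment> \<open>The common centre is the mean with block \<open>j\<close> switched off.\<close>
    define v where "v = (\<Sum>j'\<in>J - {j}. a *\<^sub>R column (c j' (g j')) X)"
    have "X *v block_signal J c a (g(j := i)) - v = a *\<^sub>R column (c j i) X" for i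
      unfolding matrix_vector_mult_block_signal v_def sum.remove[OF fin(1) j] by simp
    then have near: "norm (X *v block_signal J c a (g(j := i)) - v) \<le> \<sigma> * t" for i
      using assms(1) by (simp add: col t_def)
    have disj: "disjoint_family_on (A j) I"
      unfolding disjoint_family_on_def
    proof (intro ballI impI)
      fix i i' assume ii: "i \<in> I" "i' \<in> I" "i \<noteq> i'"
      show "A j i \<inter> A j i' = {}"
      proof (rule ccontr)
        assume "A j i \<inter> A j i' \<noteq> {}"
        then obtain y where "\<eta> y (pos j i) = of_bool (i = i)" "\<eta> y (pos j i) = of_bool (i = i')"
          using ii(1) unfolding A_def by blast
        with ii(3) show False by simp
      qed
    qed
    have "real (card I) * (real (card J) powr (- (3 / 2) * \<theta>) / 4)
        \<le> (\<Sum>i\<in>I. measure (P (g(j := i))) (- A j i))"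
      unfolding P_def
      using assms(5,6,10,11)
      by (intro block_error_arith[OF _ _ _ _ t_sq]
          identification_error_ge[OF assms(1) fin(2) assms(6) A_sets disj near]) auto
    then show ?thesis by (simp add: p_def)
  qed
  have "real (card F) * (real (card J) * p) = (\<Sum>j\<in>J. real (card F) * p)"
    by simp
  also have "\<dots> \<le> (\<Sum>j\<in>J. \<Sum>f\<in>F. measure (P f) (- A j (f j)))"
    unfolding F_def using slice by (intro sum_mono sum_PiE_ge[OF fin]) auto
  also have "\<dots> = (\<Sum>f\<in>F. \<Sum>j\<in>J. measure (P f) (- A j (f j)))"
    by (rule sum.swap)
  finally have avg: "real (card F) * (real (card J) * p) \<le> (\<Sum>f\<in>F. \<Sum>j\<in>J. measure (P f) (- A j (f j)))" .
  have "finite F" "F \<noteq> {}"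
    using fin assms(6) by (auto simp: F_def finite_PiE PiE_eq_empty_iff)
  have "\<exists>f\<in>F. real (card J) * p \<le> (\<Sum>j\<in>J. measure (P f) (- A j (f j)))"
  proof (rule ccontr)
    assume "\<not> ?thesis"
    then have "(\<Sum>f\<in>F. \<Sum>j\<in>J. measure (P f) (- A j (f j))) < (\<Sum>f\<in>F. real (card J) * p)"
      using \<open>finite F\<close> \<open>F \<noteq> {}\<close> by (intro sum_strict_mono) auto
    with avg show False by simp
  qed
  then obtain f where f: "f \<in> F" and risk: "real (card J) * p \<le> (\<Sum>j\<in>J. measure (P f) (- A j (f j)))"
    by blast
  interpret P: prob_space "P f" unfolding P_def by (rule prob_space_observation_law)
  have sets_P: "sets (P f) = sets borel" by (simp add: P_def observation_law_def)
  have "real (card J) powr (1 - 3 / 2 * \<theta>) / 4 = real (card J) * p"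
    using assms(5) powr_add[of "real (card J)" 1 "- (3 / 2) * \<theta>"] by (simp add: p_def)
  then have "ennreal (real (card J) powr (1 - 3 / 2 * \<theta>) / 4) \<le> ennreal (\<Sum>j\<in>J. measure (P f) (- A j (f j)))"
    using risk by (simp add: ennreal_leI)
  also have "\<dots> = (\<Sum>j\<in>J. emeasure (P f) (- A j (f j)))"
    by (simp add: P.emeasure_eq_measure sum_ennreal)
  also have "\<dots> = (\<integral>\<^sup>+ y. (\<Sum>j\<in>J. indicator (- A j (f j)) y) \<partial>P f)"
    using borel_comp[OF A_sets]
    by (subst nn_integral_sum) (auto intro!: borel_measurable_indicator simp: sets_P)
  also have "\<dots> \<le> (\<integral>\<^sup>+ y. ennreal (\<Sum>k\<in>UNIV. \<bar>\<eta> y k - pattern (block_signal J c a f) k\<bar>) \<partial>P f)"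
  proof (rule nn_integral_mono)
    fix y
    have "(\<Sum>j\<in>J. indicator (- A j (f j)) y :: ennreal)
        = (\<Sum>j\<in>J. ennreal (of_bool (\<not> (\<forall>i\<in>I. \<eta> y (pos j i) = of_bool (i = f j)))))"
      by (intro sum.cong) (auto simp: A_def indicator_def)
    also have "\<dots> = ennreal (\<Sum>j\<in>J. of_bool (\<not> (\<forall>i\<in>I. \<eta> y (pos j i) = of_bool (i = f j))))"
      by (rule sum_ennreal) simp
    also have "\<dots> \<le> ennreal (\<Sum>k\<in>UNIV. \<bar>\<eta> y k - pattern (block_signal J c a f) k\<bar>)"
      using f pat by (intro ennreal_leI Hamming_loss_ge_block_errors fin inj binary) (auto simp: F_def)
    finally show "(\<Sum>j\<in>J. indicator (- A j (f j)) y)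
        \<le> ennreal (\<Sum>k\<in>UNIV. \<bar>\<eta> y k - pattern (block_signal J c a f) k\<bar>)" .
  qed
  also have "\<dots> \<le> (SUP \<beta>\<in>B. \<integral>\<^sup>+ y. ennreal (\<Sum>k\<in>UNIV. \<bar>\<eta> y k - pattern \<beta> k\<bar>) \<partial>observation_law X \<sigma> \<beta>)"
    unfolding P_def using mem f by (intro SUP_upper) (simp add: F_def)
  finally show "ennreal (real (card J) powr (1 - 3 / 2 * \<theta>) / 4)
      \<le> (SUP \<beta>\<in>B. \<integral>\<^sup>+ y. ennreal (\<Sum>k\<in>UNIV. \<bar>\<eta> y k - pattern \<beta> k\<bar>) \<partial>observation_law X \<sigma> \<beta>)" .
qed

section \<open>Group selection and entry selection\<close>

lemma ex_inj_on_grid: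
  assumes "k * l \<le> CARD('a::finite)"
  shows "\<exists>pos :: nat \<Rightarrow> nat \<Rightarrow> 'a. inj_on (\<lambda>(j, i). pos j i) ({..<k} \<times> {..<l})"
proof -
  have "card ({..<k} \<times> {..<l}) \<le> card (UNIV :: 'a set)"
    using assms by (simp add: card_cartesian_product)
  then obtain f :: "nat \<times> nat \<Rightarrow> 'a" where "inj_on f ({..<k} \<times> {..<l})"
    using card_le_inj[of "{..<k} \<times> {..<l}" "UNIV :: 'a set"] by auto
  then have "inj_on (\<lambda>(j, i). curry f j i) ({..<k} \<times> {..<l})"
    by (simp add: case_prod_unfold)
  then show ?thesis by blast
qed

lemma
  assumes inj: "inj_on (\<lambda>(j, i). pos j i) (J \<times> I)" and f: "f \<in> (\<Pi>\<^sub>E _\<in>J. I)"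
  shows inj_on_choice: "inj_on (\<lambda>j. pos j (f j)) J"
    and choice_mem_iff: "j \<in> J \<Longrightarrow> i \<in> I \<Longrightarrow> pos j i \<in> (\<lambda>j. pos j (f j)) ` J \<longleftrightarrow> i = f j"
proof -
  have eq: "(j, i) = (j', i')"
    if "pos j i = pos j' i'" "j \<in> J" "i \<in> I" "j' \<in> J" "i' \<in> I" for j i j' i'
    using inj_onD[OF inj, of "(j, i)" "(j', i')"] that by simp
  have fI: "f j \<in> I" if "j \<in> J" for j using f that by auto
  show "inj_on (\<lambda>j. pos j (f j)) J"
    using eq fI by (intro inj_onI) blast
  show "j \<in> J \<Longrightarrow> i \<in> I \<Longrightarrow> pos j i \<in> (\<lambda>j. pos j (f j)) ` J \<longleftrightarrow> i = f j"
    using eq fI by blast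
qed

lemma active_groups_eq: "active_groups \<beta> = snd ` supp \<beta>"
  by (force simp: active_groups_def supp_def group_part_def vec_eq_iff image_iff)

lemma group_pattern_eq: "group_pattern \<beta> j = of_bool (j \<in> snd ` supp \<beta>)"
  unfolding active_groups_eq[symmetric] by (simp add: group_pattern_def active_groups_def)

lemma supp_block_signal:
  assumes "finite J" and "a \<noteq> 0" and "inj_on (\<lambda>j. c j (f j)) J"
  shows "supp (block_signal J c a f) = (\<lambda>j. c j (f j)) ` J"
  using assms(2) by (auto simp: supp_def block_signal_nth[of J c f, OF assms(1,3)])

lemma diff_less_mult_div:
  fixes k N :: nat
  assumes "0 < k"
  shows "real N - real k < real k * real (N div k)"
proof -
  have "N < k + k * (N div k)"
    using assms by (metis add.commute div_mult_mod_eq mod_less_divisor mult.commute nat_add_left_cancel_less)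
  then have "real N < real (k + k * (N div k))" by (simp only: of_nat_less_iff)
  then show ?thesis by simp
qed

text \<open>
  A position is a whole group, represented by one fixed coordinate with value \<open>b\<close>. The exponent is
  \<open>1 - 3/2 * 1/5 = 7/10\<close>.
\<close>
lemma minimax_group_risk_ge:
  fixes X :: "real ^ ('d::finite \<times> 'm::finite) ^ 'n::finite"
  assumes "\<sigma> > 0" and col: "\<And>k. norm (column k X) = sqrt (real CARD('n))"
    and "25 \<le> s" and "2 * s \<le> CARD('m)" and "1 \<le> s\<^sub>0" and "b > 0"
    and snr: "real CARD('n) * b\<^sup>2 / \<sigma>\<^sup>2 \<le> 1 / 5 * ln (real CARD('m) - real s)"
  shows "ennreal (real s powr (7 / 10) / 4) \<le> minimax_Hamming_risk X \<sigma> (Theta_g s s\<^sub>0 b) group_pattern"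
proof -
  define M where "M = CARD('m) div s"
  have "2 \<le> M" using assms(3,4) div_le_mono[of "2 * s" "CARD('m)" s] by (simp add: M_def)
  obtain pos :: "nat \<Rightarrow> nat \<Rightarrow> 'm" where inj: "inj_on (\<lambda>(j, i). pos j i) ({..<s} \<times> {..<M})"
    using ex_inj_on_grid[of s M, where 'a = 'm] by (auto simp: M_def)
  \<comment> \<open>Any fixed coordinate of a group will do, and \<open>undefined\<close> names one.\<close>
  define c where "c = (\<lambda>j i. (undefined :: 'd, pos j i))"
  have signal: "inj_on (\<lambda>j. c j (f j)) {..<s}"
      "supp (block_signal {..<s} c b f) = (\<lambda>j. c j (f j)) ` {..<s}"
    if "f \<in> (\<Pi>\<^sub>E _\<in>{..<s}. {..<M})" for f
  proof -
    show "inj_on (\<lambda>j. c j (f j)) {..<s}"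
      using inj_on_choice[OF inj that] by (simp add: c_def inj_on_def)
    then show "supp (block_signal {..<s} c b f) = (\<lambda>j. c j (f j)) ` {..<s}"
      using \<open>b > 0\<close> by (intro supp_block_signal) auto
  qed
  have "ennreal (real (card {..<s}) powr (1 - 3 / 2 * (1 / 5)) / 4)
      \<le> minimax_Hamming_risk X \<sigma> (Theta_g s s\<^sub>0 b) group_pattern"
  proof (rule minimax_Hamming_risk_ge_block[where I = "{..<M}" and c = c and a = b and pos = pos])
    fix f assume f: "f \<in> (\<Pi>\<^sub>E _\<in>{..<s}. {..<M})"
    let ?\<beta> = "block_signal {..<s} c b f"
    have supp: "supp ?\<beta> = (\<lambda>j. c j (f j)) ` {..<s}" by (rule signal(2)[OF f])
    have "card (active_groups ?\<beta>) \<le> card (supp ?\<beta>)"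
      unfolding active_groups_eq by (rule card_image_le) simp
    moreover have "card (supp ?\<beta>) \<le> s"
      unfolding supp using card_image_le[of "{..<s}"] by simp
    moreover from this have "card (supp ?\<beta>) \<le> s * s\<^sub>0"
      by (rule order_trans) (use assms(5) in simp)
    moreover have "b \<le> norm (group_part ?\<beta> j)" if j: "j \<in> active_groups ?\<beta>" for j
    proof -
      obtain i where i: "(i, j) \<in> supp ?\<beta>"
        using j unfolding active_groups_eq by auto
      then have "b = \<bar>group_part ?\<beta> j $ i\<bar>"
        using assms(6) unfolding supp by (simp add: group_part_def block_signal_nth[of _ c f, OF _ signal(1)[OF f]])
      then show ?thesis using component_le_norm_cart[of "group_part ?\<beta> j" i] by simp
    qed
    ultimately show "?\<beta> \<in> Theta_g s s\<^sub>0 b"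
      by (auto simp: Theta_g_def Theta_def)
    fix j i assume "j \<in> {..<s}" "i \<in> {..<M}"
    from choice_mem_iff[OF inj f this]
    show "group_pattern ?\<beta> (pos j i) = of_bool (i = f j)"
      unfolding group_pattern_eq supp image_image by (simp add: c_def)
  next
    have "ln (real CARD('m) - real s) \<le> ln (real (card {..<s}) * real (card {..<M}))"
      using diff_less_mult_div[of s "CARD('m)"] assms(3,4) by (intro ln_mono) (auto simp: M_def)
    then show "real CARD('n) * b\<^sup>2 / \<sigma>\<^sup>2 \<le> 1 / 5 * ln (real (card {..<s}) * real (card {..<M}))"
      using snr by linarith
  qed (use assms(1,3) col \<open>2 \<le> M\<close> inj in auto)
  then show ?thesis by simp
qed

text \<open>
  The active groups are known and only the positions inside them are not. Each of the \<open>s\<close> groups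
  holds \<open>s\<^sub>0\<close> blocks, so it has exactly \<open>s\<^sub>0\<close> entries \<open>b / sqrt s\<^sub>0\<close> whatever the choice, and the constraint
  on the group norms is always met. The exponent is \<open>1 - 3/2 * 1/100 = 197/200\<close>.
\<close>
lemma minimax_entry_risk_ge:
  fixes X :: "real ^ ('d::finite \<times> 'm::finite) ^ 'n::finite"
  assumes "\<sigma> > 0" and col: "\<And>k. norm (column k X) = sqrt (real CARD('n))"
    and "25 \<le> s * s\<^sub>0" and "s \<le> CARD('m)" and "2 * s\<^sub>0 \<le> CARD('d)" and "b > 0"
    and snr: "real CARD('n) * (b\<^sup>2 / real s\<^sub>0) / \<sigma>\<^sup>2
      \<le> 1 / 100 * ln (real s * real CARD('d) - real s * real s\<^sub>0)"
  shows "ennreal ((real s * real s\<^sub>0) powr (197 / 200) / 4)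
    \<le> minimax_Hamming_risk X \<sigma> (Theta_g s s\<^sub>0 b) entry_pattern"
proof -
  define M where "M = CARD('d) div s\<^sub>0"
  have "0 < s" "0 < s\<^sub>0" using assms(3) by (auto intro: Nat.gr0I)
  have "2 \<le> M" using \<open>0 < s\<^sub>0\<close> assms(5) div_le_mono[of "2 * s\<^sub>0" "CARD('d)" s\<^sub>0] by (simp add: M_def)
  obtain G :: "'m set" where G: "card G = s"
    using obtain_subset_with_card_n[OF assms(4)] by blast
  have "finite G" by simp
  obtain g :: "nat \<Rightarrow> nat \<Rightarrow> 'd" where g: "inj_on (\<lambda>(l, i). g l i) ({..<s\<^sub>0} \<times> {..<M})"
    using ex_inj_on_grid[of s\<^sub>0 M, where 'a = 'd] by (auto simp: M_def)
  define J where "J = G \<times> {..<s\<^sub>0}"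
  define c where "c = (\<lambda>j i. (g (snd j) i, fst j :: 'm))"
  define a where "a = b / sqrt (real s\<^sub>0)"
  have "finite J" and card_J: "card J = s * s\<^sub>0"
    by (simp_all add: J_def G card_cartesian_product)
  have "a > 0" using assms(6) \<open>0 < s\<^sub>0\<close> by (simp add: a_def)
  have a_sq: "a\<^sup>2 = b\<^sup>2 / real s\<^sub>0" by (simp add: a_def power_divide)
  have inj: "inj_on (\<lambda>(j, i). c j i) (J \<times> {..<M})"
    using g by (auto simp: inj_on_def c_def J_def)
  have "ennreal (real (card J) powr (1 - 3 / 2 * (1 / 100)) / 4)
      \<le> minimax_Hamming_risk X \<sigma> (Theta_g s s\<^sub>0 b) entry_pattern"
  proof (rule minimax_Hamming_risk_ge_block[where I = "{..<M}" and c = c and a = a and pos = c])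
    fix f assume f: "f \<in> (\<Pi>\<^sub>E _\<in>J. {..<M})"
    let ?\<beta> = "block_signal J c a f"
    note inj_f = inj_on_choice[OF inj f]
    have supp: "supp ?\<beta> = (\<lambda>j. c j (f j)) ` J"
      using \<open>a > 0\<close> by (intro supp_block_signal \<open>finite J\<close> inj_f) simp
    have active: "active_groups ?\<beta> \<subseteq> G"
      unfolding active_groups_eq supp by (auto simp: c_def J_def)
    then have "card (active_groups ?\<beta>) \<le> s"
      using card_mono[OF \<open>finite G\<close>] G by auto
    moreover have "card (supp ?\<beta>) \<le> s * s\<^sub>0"
      unfolding supp card_J[symmetric] by (rule card_image_le[OF \<open>finite J\<close>])
    moreover have "b \<le> norm (group_part ?\<beta> j)" if "j \<in> active_groups ?\<beta>" for j
    proof -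
      have "j \<in> G" using that active by auto
      define S where "S = (\<lambda>l. g l (f (j, l))) ` {..<s\<^sub>0}"
      have "inj_on (\<lambda>l. g l (f (j, l))) {..<s\<^sub>0}"
        using inj_f \<open>j \<in> G\<close> by (auto simp: inj_on_def c_def J_def)
      then have "card S = s\<^sub>0" by (simp add: S_def card_image)
      have entry: "group_part ?\<beta> j $ i = a" if "i \<in> S" for i
      proof -
        obtain l where "l < s\<^sub>0" "i = g l (f (j, l))" using \<open>i \<in> S\<close> by (auto simp: S_def)
        then have "(i, j) = c (j, l) (f (j, l))" "(j, l) \<in> J"
          using \<open>j \<in> G\<close> by (simp_all add: c_def J_def)
        then have "(i, j) \<in> (\<lambda>k. c k (f k)) ` J" by (rule image_eqI)
        then show ?thesis
          by (simp add: group_part_def block_signal_nth[of J c f, OF \<open>finite J\<close> inj_f])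
      qed
      have "b\<^sup>2 = (\<Sum>i\<in>S. (group_part ?\<beta> j $ i)\<^sup>2)"
        using \<open>0 < s\<^sub>0\<close> by (simp add: entry \<open>card S = s\<^sub>0\<close> a_sq)
      also have "\<dots> \<le> (\<Sum>i\<in>UNIV. (group_part ?\<beta> j $ i)\<^sup>2)"
        by (rule sum_mono2) auto
      also have "\<dots> = (norm (group_part ?\<beta> j))\<^sup>2"
        by (simp add: norm_vec_def L2_set_def sum_nonneg)
      finally show ?thesis by (rule power2_le_imp_le) simp
    qed
    ultimately show "?\<beta> \<in> Theta_g s s\<^sub>0 b"
      by (simp add: Theta_g_def Theta_def)
    fix j i assume "j \<in> J" "i \<in> {..<M}"
    from choice_mem_iff[OF inj f this]
    show "entry_pattern ?\<beta> (c j i) = of_bool (i = f j)"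
      unfolding supp[symmetric] by (simp add: entry_pattern_def supp_def)
  next
    have "real s * (real CARD('d) - real s\<^sub>0) \<le> real s * (real s\<^sub>0 * real M)"
      using diff_less_mult_div[OF \<open>0 < s\<^sub>0\<close>, of "CARD('d)"] by (intro mult_left_mono) (auto simp: M_def)
    moreover have "0 < real s * (real CARD('d) - real s\<^sub>0)"
      using \<open>0 < s\<close> \<open>0 < s\<^sub>0\<close> assms(5) by (intro mult_pos_pos) auto
    ultimately have "ln (real s * real CARD('d) - real s * real s\<^sub>0) \<le> ln (real (card J) * real (card {..<M}))"
      by (intro ln_mono) (simp_all add: card_J algebra_simps)
    then show "real CARD('n) * a\<^sup>2 / \<sigma>\<^sup>2 \<le> 1 / 100 * ln (real (card J) * real (card {..<M}))"
      using snr unfolding a_sq by linarith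
  qed (use assms(1,3) col \<open>2 \<le> M\<close> inj \<open>finite J\<close> card_J in auto)
  then show ?thesis by (simp add: card_J)
qed

theorem theorem6:
  fixes X :: "real ^ ('d::finite \<times> 'm::finite) ^ 'n::finite"
    and \<sigma> \<delta> b :: real
    and s s\<^sub>0 :: nat
  assumes "\<sigma> > 0"
    and "s\<^sub>0 \<ge> 1"
    and "\<And>k. norm (column k X) = sqrt (real CARD('n))"
    and "25 \<le> s" and "real s < real CARD('m) / 2"
    and "real s\<^sub>0 < real CARD('d) / 2"
    and "s * s\<^sub>0 \<ge> 87"
    and "real s \<le> 0.061 * real s\<^sub>0 powr (- 1 / 6) * exp (0.1563 * real s\<^sub>0)"
    and "0 < \<delta>" and "\<delta> < 1"
    and "DSRIP X s s\<^sub>0 \<delta>"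
    and "b > 0"
    and "b\<^sup>2 \<le> \<sigma>\<^sup>2 / (10 * real CARD('n)) *
           (ln (real CARD('m) - real s) / (1 + \<delta>)
            + real s\<^sub>0 / 20 * ln (real s * real CARD('d) - real s * real s\<^sub>0))"
  shows "minimax_Hamming_risk X \<sigma> (Theta_g s s\<^sub>0 b) entry_pattern
           \<ge> ennreal ((real s * real s\<^sub>0) powr (4 / 5) / 100)
       \<or> minimax_Hamming_risk X \<sigma> (Theta_g s s\<^sub>0 b) group_pattern
           \<ge> ennreal (real s powr (7 / 10) / 20)"
proof -
  define U where "U = ln (real CARD('m) - real s) / (1 + \<delta>)"
  define V where "V = real s\<^sub>0 / 20 * ln (real s * real CARD('d) - real s * real s\<^sub>0)"
  have "real CARD('n) > 0" by simp
  have snr: "real CARD('n) * b\<^sup>2 / \<sigma>\<^sup>2 \<le> (U + V) / 10"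
    using assms(13) \<open>\<sigma> > 0\<close> unfolding U_def[symmetric] V_def[symmetric] by (simp add: field_simps)
  show ?thesis
  proof (cases "V \<le> U")
    case True
    have "0 \<le> ln (real CARD('m) - real s)" using assms(4,5) by simp
    then have "ln (real CARD('m) - real s) / (1 + \<delta>) \<le> ln (real CARD('m) - real s) / 1"
      using assms(9) by (intro divide_left_mono) auto
    then have U_le: "U \<le> ln (real CARD('m) - real s)" by (simp add: U_def)
    have "(U + V) / 10 \<le> 1 / 5 * U" using True by simp
    also have "\<dots> \<le> 1 / 5 * ln (real CARD('m) - real s)" using U_le by simp
    finally have "real CARD('n) * b\<^sup>2 / \<sigma>\<^sup>2 \<le> 1 / 5 * ln (real CARD('m) - real s)"
      by (rule order_trans[OF snr])
    then have "ennreal (real s powr (7 / 10) / 4) \<le> minimax_Hamming_risk X \<sigma> (Theta_g s s\<^sub>0 b) group_pattern"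
      using assms(1-5,12) by (intro minimax_group_risk_ge) auto
    moreover have "ennreal (real s powr (7 / 10) / 20) \<le> ennreal (real s powr (7 / 10) / 4)"
      by (intro ennreal_leI) simp
    ultimately show ?thesis using order_trans by blast
  next
    case False
    have "real CARD('n) * (b\<^sup>2 / real s\<^sub>0) / \<sigma>\<^sup>2 = real CARD('n) * b\<^sup>2 / \<sigma>\<^sup>2 / real s\<^sub>0"
      by simp
    also have "\<dots> \<le> (V / 5) / real s\<^sub>0"
      using False by (intro divide_right_mono order_trans[OF snr]) auto
    also have "\<dots> = 1 / 100 * ln (real s * real CARD('d) - real s * real s\<^sub>0)"
      using assms(2) by (simp add: V_def)
    finally have "ennreal ((real s * real s\<^sub>0) powr (197 / 200) / 4)
        \<le> minimax_Hamming_risk X \<sigma> (Theta_g s s\<^sub>0 b) entry_pattern"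
      using assms(1,3,5-7,12) by (intro minimax_entry_risk_ge) auto
    moreover have "ennreal ((real s * real s\<^sub>0) powr (4 / 5) / 100)
        \<le> ennreal ((real s * real s\<^sub>0) powr (197 / 200) / 4)"
    proof -
      have "1 * 1 \<le> real s * real s\<^sub>0" using assms(2,4) by (intro mult_mono) auto
      then have "(real s * real s\<^sub>0) powr (4 / 5) \<le> (real s * real s\<^sub>0) powr (197 / 200)"
        by (intro powr_mono) auto
      then show ?thesis by (intro ennreal_leI frac_le) auto
    qed
    ultimately show ?thesis using order_trans by blast
  qed
qed

end
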